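(* Let $\Gamma$, $C=(c_{ij})_{i,j\in I}$ be associated to a Coxeter group $W$ as described in the context. Assume that $c_{ij}=c_{ji}$ whenever $n_{ij}$ is odd (and finite). Then a configuration $v\in\mathbb{R}^I$ can reach a forbidden configuration by playing the (weighted) numbers game if and only if $\beta\cdot v<-1$ for some $\beta\in\Delta_+$, and in this case the minimum number of moves required to take $v$ to a forbidden configuration is $$m(v):=\min\{\mathrm{dp}(\beta)-1 \mid \beta\cdot v<-1,\ \beta\in\Delta_+\}.$$ Furthermore, if $v$ is allowed (not forbidden) and $v_i<0$, then $m(f_iv)\in\{m(v),m(v)-1\}$ (with the convention that $m(v)=\infty$ if the set above is empty, and $\infty-1=\infty$).
   Context: Setting: $\Gamma$ is a finite graph with vertex set $I$, without loops or multiple edges. $W$ is the Coxeter group with generators $s_i$ ($i\in I$) and relations $(s_is_j)^{n_{ij}}=1$, where $n_{ii}=1$, $n_{ij}=n_{ji}\in\{2,3,\dots\}\cup\{\infty\}$ for $i\ne j$ (no relation if $n_{ij}=\infty$), and distinct $i,j$ are adjacent in $\Gamma$ exactly when $n_{ij}\geq3$. $C=(c_{ij})$ is a real matrix with $c_{ii}=2$ for all $i$, $c_{ij}=0$ whenever $i\ne j$ are not adjacent, and for adjacent $i,j$: $c_{ij},c_{ji}<0$ and either $c_{ij}c_{ji}=4\cos^2(\pi/n_{ij})$ if $n_{ij}$ is finite, or $c_{ij}c_{ji}\ge4$ if $n_{ij}=\infty$. Weighted numbers game: configurations are $v\in\mathbb{R}^I$; if $v_i<0$ one may fire $i$, replacing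 $v$ by $f_i(v)$ with $f_i(v)_j=v_j-c_{ij}v_i$. A configuration is forbidden if some $v_i<-1$, and allowed otherwise. A configuration which is itself forbidden reaches a forbidden configuration in $0$ moves. $W$ acts on $\mathbb{R}^I$ (basis of elementary vectors $\alpha_i$, the simple roots) by $s_i(\beta)_j=\beta_j$ for $j\ne i$ and $s_i(\beta)_i=-\beta_i-\sum_{k\ne i}c_{ik}\beta_k$. The set of (real) roots is $\Delta=\bigcup_{i\in I}W\alpha_i$, and $\Delta_+$ is the set of roots all of whose entries are nonnegative; one has $\Delta=\Delta_+\sqcup(-\Delta_+)$. The depth $\mathrm{dp}(\beta)$ of $\beta\in\Delta_+$ is the minimum number of simple reflections required to take $\beta$ to a negative root. The symbol $\cdot$ is the standard dot product on $\mathbb{R}^I$. *)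

theory Defs
  imports "HOL-Analysis.Analysis" "HOL-Algebra.Group_Action" "HOL-Library.Extended_Nat"
begin

section \<open>Coxeter groups\<close>

text \<open>The generators are indexed by the finite type \<open>'i\<close>, which plays the role of \<open>I\<close>.  The
  exponents \<open>n i j\<close> are extended naturals, \<open>\<infinity>\<close> meaning that there is no relation.\<close>

definition coxeter_matrix :: "('i \<Rightarrow> 'i \<Rightarrow> enat) \<Rightarrow> bool" where
  "coxeter_matrix n \<longleftrightarrow>
     (\<forall>i. n i i = 1) \<and> (\<forall>i j. n i j = n j i) \<and> (\<forall>i j. i \<noteq> j \<longrightarrow> 2 \<le> n i j)"

definition adjacent :: "('i \<Rightarrow> 'i \<Rightarrow> enat) \<Rightarrow> 'i \<Rightarrow> 'i \<Rightarrow> bool" where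
  "adjacent n i j \<longleftrightarrow> i \<noteq> j \<and> 3 \<le> n i j"

text \<open>The presentation of \<open>W\<close>: elements are words in the generators modulo the congruence
  generated by \<open>(s\<^sub>i s\<^sub>j)\<^bsup>n i j\<^esup> = 1\<close>.  As \<open>n i i = 1\<close> gives \<open>s\<^sub>i s\<^sub>i = 1\<close>, no formal inverses of
  the generators are needed, and the class of \<open>rev w\<close> is the inverse of the class of \<open>w\<close>.\<close>

inductive_set coxeter_rel :: "('i \<Rightarrow> 'i \<Rightarrow> enat) \<Rightarrow> ('i list \<times> 'i list) set"
  for n :: "'i \<Rightarrow> 'i \<Rightarrow> enat" where
  relator: "n i j = enat k \<Longrightarrow> (u @ concat (replicate k [i, j]) @ v, u @ v) \<in> coxeter_rel n"
| refl: "(u, u) \<in> coxeter_rel n"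
| sym: "(u, v) \<in> coxeter_rel n \<Longrightarrow> (v, u) \<in> coxeter_rel n"
| trans: "(u, v) \<in> coxeter_rel n \<Longrightarrow> (v, w) \<in> coxeter_rel n \<Longrightarrow> (u, w) \<in> coxeter_rel n"

definition coxeter_group :: "('i \<Rightarrow> 'i \<Rightarrow> enat) \<Rightarrow> 'i list set monoid" where
  "coxeter_group n =
     \<lparr>carrier = UNIV // coxeter_rel n,
      mult = \<lambda>X Y. \<Union>u\<in>X. \<Union>v\<in>Y. coxeter_rel n `` {u @ v},
      one = coxeter_rel n `` {[]}\<rparr>"

section \<open>The action on the root space and the roots\<close>

definition cartan_matrix :: "('i::finite \<Rightarrow> 'i \<Rightarrow> enat) \<Rightarrow> real ^ 'i ^ 'i \<Rightarrow> bool" where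
  "cartan_matrix n C \<longleftrightarrow>
     (\<forall>i. C $ i $ i = 2) \<and>
     (\<forall>i j. i \<noteq> j \<and> \<not> adjacent n i j \<longrightarrow> C $ i $ j = 0) \<and>
     (\<forall>i j. adjacent n i j \<longrightarrow>
        C $ i $ j < 0 \<and> C $ j $ i < 0 \<and>
        (case n i j of
           enat k \<Rightarrow> C $ i $ j * C $ j $ i = 4 * (cos (pi / real k))\<^sup>2
         | \<infinity> \<Rightarrow> C $ i $ j * C $ j $ i \<ge> 4))"

definition simple_root :: "'i::finite \<Rightarrow> real ^ 'i" where
  "simple_root i = axis i 1"

definition simple_refl :: "real ^ 'i ^ 'i \<Rightarrow> 'i::finite \<Rightarrow> real ^ 'i \<Rightarrow> real ^ 'i" where
  "simple_refl C i \<beta> =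
     (\<chi> j. if j = i then - (\<beta> $ i) - (\<Sum>k\<in>UNIV - {i}. C $ i $ k * \<beta> $ k) else \<beta> $ j)"

text \<open>The word \<open>[i\<^sub>1, \<dots>, i\<^sub>k]\<close> acts as \<open>s\<^bsub>i\<^sub>1\<^esub> \<circ> \<dots> \<circ> s\<^bsub>i\<^sub>k\<^esub>\<close>.\<close>

definition word_act :: "real ^ 'i ^ 'i \<Rightarrow> 'i::finite list \<Rightarrow> real ^ 'i \<Rightarrow> real ^ 'i" where
  "word_act C w = foldr (simple_refl C) w"

text \<open>A group element acts through any word representing it; the choice is immaterial by
  \<open>coxeter_act_class\<close> below.\<close>

definition coxeter_act :: "real ^ 'i ^ 'i \<Rightarrow> 'i::finite list set \<Rightarrow> real ^ 'i \<Rightarrow> real ^ 'i" where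
  "coxeter_act C X = word_act C (SOME w. w \<in> X)"

definition roots :: "('i::finite \<Rightarrow> 'i \<Rightarrow> enat) \<Rightarrow> real ^ 'i ^ 'i \<Rightarrow> (real ^ 'i) set" where
  "roots n C = (\<Union>i. orbit (coxeter_group n) (coxeter_act C) (simple_root i))"

definition pos_roots :: "('i::finite \<Rightarrow> 'i \<Rightarrow> enat) \<Rightarrow> real ^ 'i ^ 'i \<Rightarrow> (real ^ 'i) set" where
  "pos_roots n C = {\<beta> \<in> roots n C. \<forall>j. 0 \<le> \<beta> $ j}"

text \<open>Minima of sets of natural numbers are taken as infima in \<^typ>\<open>enat\<close>: these are attained
  for nonempty sets and equal to \<open>\<infinity>\<close> for the empty set.\<close>

definition depth :: "('i::finite \<Rightarrow> 'i \<Rightarrow> enat) \<Rightarrow> real ^ 'i ^ 'i \<Rightarrow> real ^ 'i \<Rightarrow> enat" where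
  "depth n C \<beta> = (INF w \<in> {w. word_act C w \<beta> \<in> uminus ` pos_roots n C}. enat (length w))"

section \<open>The weighted numbers game\<close>

definition fire :: "real ^ 'i ^ 'i \<Rightarrow> 'i::finite \<Rightarrow> real ^ 'i \<Rightarrow> real ^ 'i" where
  "fire C i v = (\<chi> j. v $ j - C $ i $ j * v $ i)"

definition move :: "real ^ 'i ^ 'i \<Rightarrow> real ^ 'i::finite \<Rightarrow> real ^ 'i \<Rightarrow> bool" where
  "move C v u \<longleftrightarrow> (\<exists>i. v $ i < 0 \<and> u = fire C i v)"

definition forbidden :: "real ^ 'i::finite \<Rightarrow> bool" where
  "forbidden v \<longleftrightarrow> (\<exists>i. v $ i < -1)"

definition reaches_forbidden_in :: "real ^ 'i ^ 'i \<Rightarrow> real ^ 'i::finite \<Rightarrow> nat \<Rightarrow> bool" where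
  "reaches_forbidden_in C v k \<longleftrightarrow> (\<exists>u. (move C ^^ k) v u \<and> forbidden u)"

definition min_moves :: "real ^ 'i ^ 'i \<Rightarrow> real ^ 'i::finite \<Rightarrow> enat" where
  "min_moves C v = (INF k \<in> {k. reaches_forbidden_in C v k}. enat k)"

text \<open>Subtraction on \<^typ>\<open>enat\<close> satisfies \<open>\<infinity> - 1 = \<infinity>\<close>.\<close>

definition m_number :: "('i::finite \<Rightarrow> 'i \<Rightarrow> enat) \<Rightarrow> real ^ 'i ^ 'i \<Rightarrow> real ^ 'i \<Rightarrow> enat" where
  "m_number n C v = (INF \<beta> \<in> {\<beta> \<in> pos_roots n C. \<beta> \<bullet> v < -1}. depth n C \<beta> - 1)"

section \<open>The definitions above give a group acting on the root space\<close>

lemma equiv_coxeter_rel: "equiv UNIV (coxeter_rel n)"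
  by (intro equivI refl_onI symI transI) (auto intro: coxeter_rel.intros)

lemma coxeter_rel_cong_left:
  "(u, v) \<in> coxeter_rel n \<Longrightarrow> (w @ u, w @ v) \<in> coxeter_rel n"
proof (induction rule: coxeter_rel.induct)
  case (relator i j k u v)
  then show ?case using coxeter_rel.relator[of n i j k "w @ u" v] by simp
qed (blast intro: coxeter_rel.intros)+

lemma coxeter_rel_cong_right:
  "(u, v) \<in> coxeter_rel n \<Longrightarrow> (u @ w, v @ w) \<in> coxeter_rel n"
proof (induction rule: coxeter_rel.induct)
  case (relator i j k u v)
  then show ?case using coxeter_rel.relator[of n i j k u "v @ w"] by simp
qed (blast intro: coxeter_rel.intros)+

lemma coxeter_rel_cong:
  "(u, u') \<in> coxeter_rel n \<Longrightarrow> (v, v') \<in> coxeter_rel n \<Longrightarrow> (u @ v, u' @ v') \<in> coxeter_rel n"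
  by (blast intro: coxeter_rel.trans coxeter_rel_cong_left coxeter_rel_cong_right)

lemma coxeter_class_eq_iff:
  "coxeter_rel n `` {u} = coxeter_rel n `` {v} \<longleftrightarrow> (u, v) \<in> coxeter_rel n"
  by (simp add: eq_equiv_class_iff[OF equiv_coxeter_rel])

lemma coxeter_mult_class:
  "coxeter_rel n `` {u} \<otimes>\<^bsub>coxeter_group n\<^esub> coxeter_rel n `` {v} = coxeter_rel n `` {u @ v}"
proof -
  have "coxeter_rel n `` {a @ b} = coxeter_rel n `` {u @ v}"
    if "(u, a) \<in> coxeter_rel n" "(v, b) \<in> coxeter_rel n" for a b
    using coxeter_rel_cong[OF that] coxeter_class_eq_iff coxeter_rel.sym by blast
  then have "(\<Union>a\<in>coxeter_rel n `` {u}. \<Union>b\<in>coxeter_rel n `` {v}. coxeter_rel n `` {a @ b})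
      = (\<Union>a\<in>coxeter_rel n `` {u}. \<Union>b\<in>coxeter_rel n `` {v}. coxeter_rel n `` {u @ v})"
    by (intro SUP_cong) (simp_all only: Image_singleton_iff)
  moreover have "u \<in> coxeter_rel n `` {u}" "v \<in> coxeter_rel n `` {v}"
    by (simp_all add: coxeter_rel.refl)
  ultimately show ?thesis
    unfolding coxeter_group_def by (simp only: monoid.simps) blast
qed

lemma coxeter_carrier_iff:
  "X \<in> carrier (coxeter_group n) \<longleftrightarrow> (\<exists>w. X = coxeter_rel n `` {w})"
  by (auto simp: coxeter_group_def quotient_def)

lemma coxeter_rel_rev:
  assumes "coxeter_matrix n"
  shows "(rev w @ w, []) \<in> coxeter_rel n"
proof (induction w)
  case Nil
  then show ?case by (simp add: coxeter_rel.refl)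
next
  case (Cons i w)
  have "n i i = enat 1"
    using assms by (simp add: coxeter_matrix_def one_enat_def)
  from coxeter_rel.relator[where n = n and i = i and j = i and u = "rev w" and v = w, OF this]
  have "(rev (i # w) @ i # w, rev w @ w) \<in> coxeter_rel n"
    by simp
  with Cons show ?case by (blast intro: coxeter_rel.trans)
qed

lemma group_coxeter_group:
  assumes "coxeter_matrix n"
  shows "group (coxeter_group n)"
proof (rule groupI)
  show one: "\<one>\<^bsub>coxeter_group n\<^esub> \<in> carrier (coxeter_group n)"
    by (auto simp: coxeter_group_def quotient_def)
  have one_class: "\<one>\<^bsub>coxeter_group n\<^esub> = coxeter_rel n `` {[]}"
    by (simp add: coxeter_group_def)
  fix x assume "x \<in> carrier (coxeter_group n)"
  then obtain u where x: "x = coxeter_rel n `` {u}"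
    by (auto simp: coxeter_carrier_iff)
  show "\<one>\<^bsub>coxeter_group n\<^esub> \<otimes>\<^bsub>coxeter_group n\<^esub> x = x"
    by (simp add: one_class x coxeter_mult_class)
  have "coxeter_rel n `` {rev u} \<otimes>\<^bsub>coxeter_group n\<^esub> x = \<one>\<^bsub>coxeter_group n\<^esub>"
    by (simp add: one_class x coxeter_mult_class coxeter_class_eq_iff coxeter_rel_rev[OF assms])
  then show "\<exists>y\<in>carrier (coxeter_group n). y \<otimes>\<^bsub>coxeter_group n\<^esub> x = \<one>\<^bsub>coxeter_group n\<^esub>"
    using coxeter_carrier_iff by blast
qed (auto simp: coxeter_carrier_iff coxeter_mult_class)

lemma word_act_Nil [simp]: "word_act C [] = id"
  by (simp add: word_act_def)

lemma word_act_Cons [simp]: "word_act C (i # w) \<beta> = simple_refl C i (word_act C w \<beta>)"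
  by (simp add: word_act_def)

lemma word_act_append [simp]: "word_act C (u @ w) \<beta> = word_act C u (word_act C w \<beta>)"
  by (simp add: word_act_def)

lemma word_act_power:
  "word_act C (concat (replicate k [i, j])) \<beta> = ((\<lambda>\<beta>. simple_refl C i (simple_refl C j \<beta>)) ^^ k) \<beta>"
  by (induction k) auto

lemma simple_refl_involution: "simple_refl C i (simple_refl C i \<beta>) = \<beta>"
proof -
  have "(\<Sum>k\<in>UNIV - {i}. C $ i $ k * simple_refl C i \<beta> $ k) = (\<Sum>k\<in>UNIV - {i}. C $ i $ k * \<beta> $ k)"
    by (intro sum.cong) (auto simp: simple_refl_def)
  then show ?thesis
    by (simp add: vec_eq_iff) (simp add: simple_refl_def)
qed

text \<open>A solution of \<open>z\<^sub>k\<^sub>+\<^sub>2 = 2 cos t z\<^sub>k\<^sub>+\<^sub>1 - z\<^sub>k + K\<close> with \<open>t = 2 \<pi> / m\<close> is periodic of period \<open>m\<close>.\<close>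

lemma recurrence_periodic:
  fixes z :: "nat \<Rightarrow> real"
  assumes m: "3 \<le> m" and t: "t = 2 * pi / real m"
    and rec: "\<And>k. z (Suc (Suc k)) = 2 * cos t * z (Suc k) - z k + K"
  shows "z m = z 0"
proof -
  have t0: "0 < t" "t < pi" using m by (auto simp: t field_simps)
  have s: "sin t > 0" using t0 by (rule sin_gt_zero)
  have c: "cos t \<noteq> 1" using cos_monotone_0_pi[of 0 t] t0 by simp
  define y where "y k = z k - K / (2 - 2 * cos t)" for k
  have K: "K / (2 - 2 * cos t) * 2 - 2 * cos t * (K / (2 - 2 * cos t)) = K"
  proof -
    have "K / (2 - 2 * cos t) * (2 - 2 * cos t) = K" using c by simp
    then show ?thesis by (simp only: right_diff_distrib) (simp only: mult.commute)
  qed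
  have rec_y: "y (Suc (Suc k)) = 2 * cos t * y (Suc k) - y k" for k
    using rec[of k] K by (simp add: y_def algebra_simps)
  have sol: "sin t * y k = sin (real k * t) * y 1 - sin ((real k - 1) * t) * y 0 \<and>
      sin t * y (Suc k) = sin (real (Suc k) * t) * y 1 - sin (real k * t) * y 0" for k
  proof (induction k)
    case 0
    show ?case by simp
  next
    case (Suc k)
    have add: "sin (a + t) = 2 * cos t * sin a - sin (a - t)" for a
      by (simp add: sin_add sin_diff)
    have e1: "sin (real (Suc (Suc k)) * t) = 2 * cos t * sin (real (Suc k) * t) - sin (real k * t)"
      using add[of "real (Suc k) * t"] by (simp add: algebra_simps)
    have e2: "sin (real (Suc k) * t) = 2 * cos t * sin (real k * t) - sin ((real k - 1) * t)"
      using add[of "real k * t"] by (simp add: algebra_simps)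
    have "sin t * y (Suc (Suc k)) = 2 * cos t * (sin t * y (Suc k)) - sin t * y k"
      by (simp add: rec_y algebra_simps)
    also have "\<dots> = 2 * cos t * (sin (real (Suc k) * t) * y 1 - sin (real k * t) * y 0)
        - (sin (real k * t) * y 1 - sin ((real k - 1) * t) * y 0)"
      using Suc by simp
    also have "\<dots> = (2 * cos t * sin (real (Suc k) * t) - sin (real k * t)) * y 1
        - (2 * cos t * sin (real k * t) - sin ((real k - 1) * t)) * y 0"
      by (simp add: algebra_simps)
    also have "\<dots> = sin (real (Suc (Suc k)) * t) * y 1 - sin (real (Suc k) * t) * y 0"
      by (simp only: e1 e2)
    finally show ?case using Suc by simp
  qed
  have mt: "real m * t = 2 * pi" "(real m - 1) * t = 2 * pi - t"
    using m by (auto simp: t field_simps)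
  have "sin t * y m = sin t * y 0"
    using sol[of m] unfolding mt by simp
  then show ?thesis using s by (simp add: y_def)
qed

lemma simple_refl_braid:
  assumes n: "coxeter_matrix n" and C: "cartan_matrix n C" and m: "n i j = enat m"
  shows "((\<lambda>\<beta>. simple_refl C i (simple_refl C j \<beta>)) ^^ m) \<beta> = \<beta>"
proof (cases "i = j")
  case True
  then have "m = 1" using n m by (simp add: coxeter_matrix_def one_enat_def)
  then show ?thesis using True by (simp add: simple_refl_involution)
next
  case False
  define a b where "a = C $ i $ j" and "b = C $ j $ i"
  define T where "T = (\<lambda>\<beta>. simple_refl C i (simple_refl C j \<beta>))"
  define p where "p = (\<Sum>k\<in>UNIV - {i, j}. C $ i $ k * \<beta> $ k)"
  define q where "q = (\<Sum>k\<in>UNIV - {i, j}. C $ j $ k * \<beta> $ k)"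
  define B where "B k = (T ^^ k) \<beta>" for k
  have split_i: "(\<Sum>k\<in>UNIV - {i}. C $ i $ k * x $ k)
      = a * x $ j + (\<Sum>k\<in>UNIV - {i, j}. C $ i $ k * x $ k)" for x :: "real ^ 'a"
  proof -
    have "UNIV - {i} = insert j (UNIV - {i, j})" using False by auto
    then show ?thesis by (simp add: a_def)
  qed
  have split_j: "(\<Sum>k\<in>UNIV - {j}. C $ j $ k * x $ k)
      = b * x $ i + (\<Sum>k\<in>UNIV - {i, j}. C $ j $ k * x $ k)" for x :: "real ^ 'a"
  proof -
    have "UNIV - {j} = insert i (UNIV - {i, j})" using False by auto
    then show ?thesis by (simp add: b_def)
  qed
  have other_T: "T x $ l = x $ l" if "l \<notin> {i, j}" for x l
    using that by (simp add: T_def simple_refl_def)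
  have other: "B k $ l = \<beta> $ l" if "l \<notin> {i, j}" for k l
    using that by (induction k) (simp_all add: B_def other_T)
  have Tj: "T x $ j = - x $ j - b * x $ i - (\<Sum>k\<in>UNIV - {i, j}. C $ j $ k * x $ k)" for x
    using False by (simp add: T_def simple_refl_def split_j)
  have Ti: "T x $ i = - x $ i - a * T x $ j - (\<Sum>k\<in>UNIV - {i, j}. C $ i $ k * x $ k)" for x
  proof -
    have "(\<Sum>k\<in>UNIV - {i, j}. C $ i $ k * simple_refl C j x $ k)
        = (\<Sum>k\<in>UNIV - {i, j}. C $ i $ k * x $ k)"
      by (intro sum.cong) (auto simp: simple_refl_def)
    moreover have "T x $ i = - simple_refl C j x $ i
        - (a * simple_refl C j x $ j + (\<Sum>k\<in>UNIV - {i, j}. C $ i $ k * simple_refl C j x $ k))"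
      unfolding split_i[symmetric] by (simp add: T_def simple_refl_def[of C i])
    moreover have "simple_refl C j x $ i = x $ i" "simple_refl C j x $ j = T x $ j"
      using False by (simp_all add: T_def simple_refl_def)
    ultimately show ?thesis by simp
  qed
  have sums: "(\<Sum>l\<in>UNIV - {i, j}. C $ i $ l * B k $ l) = p"
      "(\<Sum>l\<in>UNIV - {i, j}. C $ j $ l * B k $ l) = q" for k
    unfolding p_def q_def by (intro sum.cong; simp add: other)+
  define x y where "x k = B k $ i" and "y k = B k $ j" for k
  have y: "y (Suc k) = - y k - b * x k - q" for k
    using Tj[of "B k"] sums by (simp add: x_def y_def B_def)
  have x: "x (Suc k) = - x k - a * y (Suc k) - p" for k
    using Ti[of "B k"] sums by (simp add: x_def y_def B_def)
  have "x m = x 0 \<and> y m = y 0"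
  proof (cases "adjacent n i j")
    case True
    then have m3: "3 \<le> m"
      using m by (simp add: adjacent_def numeral_eq_enat)
    define t where "t = 2 * pi / real m"
    have "a * b = 4 * (cos (pi / real m))\<^sup>2"
    proof -
      have "case n i j of
              enat k \<Rightarrow> C $ i $ j * C $ j $ i = 4 * (cos (pi / real k))\<^sup>2
            | \<infinity> \<Rightarrow> C $ i $ j * C $ j $ i \<ge> 4"
        using C True unfolding cartan_matrix_def by blast
      then show ?thesis by (simp add: m a_def b_def)
    qed
    also have "\<dots> = 2 * cos t + 2"
      using cos_double_cos[of "pi / real m"] by (simp add: t_def)
    finally have ab: "2 * cos t = a * b - 2" by simp
    have "x (Suc (Suc k)) = 2 * cos t * x (Suc k) - x k + (a * q - 2 * p)" for k
      unfolding ab x y by (simp add: algebra_simps)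
    moreover have "y (Suc (Suc k)) = 2 * cos t * y (Suc k) - y k + (b * p - 2 * q)" for k
      unfolding ab x y by (simp add: algebra_simps)
    ultimately show ?thesis
      using recurrence_periodic[OF m3 t_def] by blast
  next
    case nonadj: False
    have "2 \<le> n i j" using n False by (auto simp: coxeter_matrix_def)
    then have m2: "m = 2"
      using nonadj False m by (auto simp: adjacent_def numeral_eq_enat)
    have sym: "n j i = n i j" using n by (auto simp: coxeter_matrix_def)
    have "a = 0" "b = 0"
      using C nonadj False sym by (auto simp: cartan_matrix_def a_def b_def adjacent_def)
    then have "x (Suc (Suc 0)) = x 0" "y (Suc (Suc 0)) = y 0"
      by (simp_all add: x y)
    then show ?thesis by (simp add: m2 numeral_2_eq_2)
  qed
  moreover have "B 0 = \<beta>" by (simp add: B_def)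
  ultimately have "B m $ l = \<beta> $ l" for l
    using other[of l m] by (cases "l = i \<or> l = j") (auto simp: x_def y_def)
  then show ?thesis by (simp add: vec_eq_iff B_def T_def)
qed

lemma word_act_cong:
  assumes "coxeter_matrix n" "cartan_matrix n C" "(u, v) \<in> coxeter_rel n"
  shows "word_act C u = word_act C v"
  using assms(3)
proof (induction rule: coxeter_rel.induct)
  case (relator i j k u v)
  then show ?case
    by (intro ext) (simp add: word_act_power simple_refl_braid[OF assms(1,2)])
qed auto

lemma coxeter_act_class:
  assumes "coxeter_matrix n" "cartan_matrix n C"
  shows "coxeter_act C (coxeter_rel n `` {w}) = word_act C w"
proof -
  have "(SOME u. u \<in> coxeter_rel n `` {w}) \<in> coxeter_rel n `` {w}"
    by (rule someI[of _ w]) (simp add: coxeter_rel.refl)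
  then show ?thesis
    unfolding coxeter_act_def using word_act_cong[OF assms] by (metis Image_singleton_iff)
qed

lemma group_action_coxeter_act:
  assumes "coxeter_matrix n" "cartan_matrix n C"
  shows "group_action (coxeter_group n) UNIV (coxeter_act C)"
proof -
  have inv: "word_act C (rev w) (word_act C w \<beta>) = \<beta>" for w \<beta>
    using word_act_cong[OF assms coxeter_rel_rev[OF assms(1), of w]]
    by (metis id_apply word_act_Nil word_act_append)
  have "bij (word_act C w)" for w
    using inv[of w] inv[of "rev w"] by (intro o_bij[of "word_act C (rev w)"]) (auto simp: fun_eq_iff)
  then have Bij: "word_act C w \<in> Bij UNIV" for w
    by (simp add: Bij_def)
  have "coxeter_act C \<in> hom (coxeter_group n) (BijGroup UNIV)"
  proof (rule homI)
    fix X assume "X \<in> carrier (coxeter_group n)"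
    then show "coxeter_act C X \<in> carrier (BijGroup UNIV)"
      by (auto simp: coxeter_carrier_iff coxeter_act_class[OF assms] BijGroup_def Bij)
  next
    fix X Y assume "X \<in> carrier (coxeter_group n)" "Y \<in> carrier (coxeter_group n)"
    then show "coxeter_act C (X \<otimes>\<^bsub>coxeter_group n\<^esub> Y) =
        coxeter_act C X \<otimes>\<^bsub>BijGroup UNIV\<^esub> coxeter_act C Y"
      by (auto simp: coxeter_carrier_iff coxeter_mult_class coxeter_act_class[OF assms]
          BijGroup_def Bij compose_def fun_eq_iff)
  qed
  then show ?thesis
    by (simp add: group_action_def group_hom_def group_hom_axioms_def
        group_coxeter_group[OF assms(1)] group_BijGroup)
qed

end

theory Submission
  imports Defs
begin

text \<open>Firing is adjoint to the simple reflections: \<open>\<beta> \<bullet> f\<^sub>i v = s\<^sub>i \<beta> \<bullet> v\<close>.  Hence \<open>m\<close> drops by at most one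
  in a move.  Conversely, given a positive root with \<open>\<beta> \<bullet> v < -1\<close>, take \<open>i\<close> such that \<open>s\<^sub>i\<close> lowers its
  depth, which forces \<open>C\<^sub>i \<bullet> \<beta> \<ge> 0\<close>: if \<open>v\<^sub>i < 0\<close>, fire \<open>i\<close>; otherwise \<open>s\<^sub>i \<beta> \<bullet> v \<le> \<beta> \<bullet> v\<close>, so \<open>s\<^sub>i \<beta>\<close> serves for the
  same configuration.  In both cases the depth decreases, until \<open>\<beta>\<close> is simple and \<open>v\<close> is forbidden.

  As \<open>C\<close> need not be symmetrizable, there is no invariant form.  That a root is positive or
  negative, and that a root which is a positive multiple of a simple root is that simple root,
  is proved by induction on the length of group elements, reducing to the dihedral case by
  minimal coset representatives.  The hypothesis on odd exponents is what excludes proper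
  multiples in the dihedral case.\<close>

section \<open>Reduced words\<close>

definition reduced_word :: "('i \<Rightarrow> 'i \<Rightarrow> enat) \<Rightarrow> 'i list \<Rightarrow> bool" where
  "reduced_word n w \<longleftrightarrow> (\<forall>u. (w, u) \<in> coxeter_rel n \<longrightarrow> length w \<le> length u)"

text \<open>For a reduced \<open>w\<close> this says that appending \<open>i\<close> does not
  shorten the group element. All relators have even length, so the lengths before and after have
  different parity and the weak inequality amounts to an increase; stating it weakly avoids the
  parity argument.\<close>

definition ascent :: "('i \<Rightarrow> 'i \<Rightarrow> enat) \<Rightarrow> 'i list \<Rightarrow> 'i \<Rightarrow> bool" where
  "ascent n w i \<longleftrightarrow> (\<forall>u. (w @ [i], u) \<in> coxeter_rel n \<longrightarrow> length w \<le> length u)"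

lemma obtain_reduced:
  obtains u where "(w, u) \<in> coxeter_rel n" "reduced_word n u" "length u \<le> length w"
proof -
  obtain u where u: "(w, u) \<in> coxeter_rel n"
      "\<And>v. (w, v) \<in> coxeter_rel n \<Longrightarrow> length u \<le> length v"
    using ex_has_least_nat[of "\<lambda>u. (w, u) \<in> coxeter_rel n" w length] coxeter_rel.refl[of w n] by blast
  then have "reduced_word n u"
    unfolding reduced_word_def using coxeter_rel.trans by blast
  with u show thesis using that coxeter_rel.refl by blast
qed

lemma coxeter_rel_snoc_cancel:
  assumes "coxeter_matrix n"
  shows "(w @ [i, i], w) \<in> coxeter_rel n"
  using coxeter_rel_cong_left[OF coxeter_rel_rev[OF assms, of "[i]"], of w] by simp

lemma coxeter_rel_snoc_move:
  assumes "coxeter_matrix n"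
  shows "(w @ [i], u) \<in> coxeter_rel n \<longleftrightarrow> (w, u @ [i]) \<in> coxeter_rel n"
proof
  assume "(w @ [i], u) \<in> coxeter_rel n"
  then have "(w @ [i, i], u @ [i]) \<in> coxeter_rel n"
    using coxeter_rel_cong_right[of "w @ [i]" u n "[i]"] by simp
  then show "(w, u @ [i]) \<in> coxeter_rel n"
    using coxeter_rel_snoc_cancel[OF assms] coxeter_rel.sym coxeter_rel.trans by blast
next
  assume "(w, u @ [i]) \<in> coxeter_rel n"
  then have "(w @ [i], u @ [i, i]) \<in> coxeter_rel n"
    using coxeter_rel_cong_right[of w "u @ [i]" n "[i]"] by simp
  then show "(w @ [i], u) \<in> coxeter_rel n"
    using coxeter_rel_snoc_cancel[OF assms] coxeter_rel.trans by blast
qed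

lemma reduced_appendD:
  assumes "reduced_word n (v @ u)"
  shows "reduced_word n v" "reduced_word n u"
proof -
  have "length v \<le> length x" if "(v, x) \<in> coxeter_rel n" for x
    using assms coxeter_rel_cong_right[OF that, of u] by (auto simp: reduced_word_def)
  then show "reduced_word n v" by (simp add: reduced_word_def)
  have "length u \<le> length x" if "(u, x) \<in> coxeter_rel n" for x
    using assms coxeter_rel_cong_left[OF that, of v] by (auto simp: reduced_word_def)
  then show "reduced_word n u" by (simp add: reduced_word_def)
qed

lemma ascent_appendD: "ascent n (v @ u) i \<Longrightarrow> ascent n u i"
  unfolding ascent_def
  using coxeter_rel_cong_left[of "u @ [i]" _ n v] by fastforce

lemma reduced_snoc_ascent: "reduced_word n (w @ [i]) \<Longrightarrow> ascent n w i"
  by (fastforce simp: ascent_def reduced_word_def)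

lemma ascent_snoc_neq:
  assumes "coxeter_matrix n" "ascent n (w @ [t]) i"
  shows "t \<noteq> i"
  using assms coxeter_rel_snoc_cancel[OF assms(1), of w i] by (fastforce simp: ascent_def)

lemma ascent_cong:
  "reduced_word n w \<Longrightarrow> (w, u) \<in> coxeter_rel n \<Longrightarrow> length u = length w \<Longrightarrow> ascent n w i \<Longrightarrow> ascent n u i"
  unfolding ascent_def using coxeter_rel_cong_right coxeter_rel.trans by metis

lemma reduced_cong:
  "reduced_word n w \<Longrightarrow> (w, u) \<in> coxeter_rel n \<Longrightarrow> length u = length w \<Longrightarrow> reduced_word n u"
  unfolding reduced_word_def using coxeter_rel.trans by metis

text \<open>The factor \<open>v\<close> is a shortest representative of the coset of the rank two parabolic subgroup
  generated by \<open>i\<close> and \<open>t\<close>.\<close>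

lemma coset_decomposition:
  assumes n: "coxeter_matrix n" and red: "reduced_word n (w @ [t])" and asc: "ascent n (w @ [t]) i"
  obtains v u where "(w @ [t], v @ u) \<in> coxeter_rel n" "set u \<subseteq> {i, t}" "length v \<le> length w"
    "reduced_word n v" "reduced_word n u" "ascent n v i" "ascent n v t" "ascent n u i"
proof -
  \<comment> \<open>\<open>P\<close> collects the length-additive factorizations whose right factor
    uses only \<open>i\<close> and \<open>t\<close>. One with the shortest left factor is
    chosen.\<close>
  define P where "P = (\<lambda>(v, u). (w @ [t], v @ u) \<in> coxeter_rel n \<and> set u \<subseteq> {i, t} \<and>
      length v + length u = length (w @ [t]))"
  have "P (w, [t])" by (simp add: P_def coxeter_rel.refl)
  then obtain z where "P z" "\<And>y. P y \<Longrightarrow> length (fst z) \<le> length (fst y)"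
    using ex_has_least_nat[of P "(w, [t])" "\<lambda>z. length (fst z)"] by blast
  then obtain v u where P: "P (v, u)" and
    least: "\<And>v' u'. P (v', u') \<Longrightarrow> length v \<le> length v'"
    by (metis fst_conv prod.collapse)
  from P have rel: "(w @ [t], v @ u) \<in> coxeter_rel n" and u: "set u \<subseteq> {i, t}"
    and len: "length (v @ u) = length (w @ [t])"
    by (auto simp: P_def)
  note red' = reduced_cong[OF red rel len]
  have asc': "ascent n v x" if x: "x \<in> {i, t}" for x
    unfolding ascent_def
  proof (intro allI impI)
    fix y assume y: "(v @ [x], y) \<in> coxeter_rel n"
    then have "(v, y @ [x]) \<in> coxeter_rel n"
      by (simp add: coxeter_rel_snoc_move[OF n])
    from coxeter_rel_cong_right[OF this, of u] have vy: "(v @ u, y @ x # u) \<in> coxeter_rel n"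
      by simp
    then have ge: "length (v @ u) \<le> length (y @ x # u)"
      using red' unfolding reduced_word_def by blast
    show "length v \<le> length y"
    proof (rule ccontr)
      assume "\<not> length v \<le> length y"
      \<comment> \<open>As \<open>v @ u\<close> is reduced, \<open>y\<close> is exactly one letter
        shorter than \<open>v\<close>, so transferring \<open>x\<close> to the right factor keeps
        the factorization length-additive.\<close>
      then have "P (y, x # u)"
        using ge len u x coxeter_rel.trans[OF rel vy] by (simp add: P_def)
      then show False using least \<open>\<not> length v \<le> length y\<close> by blast
    qed
  qed
  \<comment> \<open>Comparison with the factorization \<open>(w, [t])\<close> bounds
    \<open>v\<close> by \<open>w\<close>: it is strictly shorter than \<open>w @ [t]\<close>, as
    induction on length will require.\<close>
  show thesis
    using that[OF rel u] least[OF \<open>P (w, [t])\<close>] reduced_appendD[OF red'] asc'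
      ascent_appendD[OF ascent_cong[OF red rel len asc]] by blast
qed

section \<open>Alternating words\<close>

text \<open>The recursion peels off the last letter, so \<open>y\<close> stays at the right end and
  the first letter depends on the parity of \<open>k\<close>. The right end is where
  \<open>ascent\<close> looks and where the action starts.\<close>

fun alternating :: "nat \<Rightarrow> 'i \<Rightarrow> 'i \<Rightarrow> 'i list" where
  "alternating 0 x y = []"
| "alternating (Suc k) x y = alternating k y x @ [y]"

lemma length_alternating [simp]: "length (alternating k x y) = k"
  by (induction k arbitrary: x y) auto

lemma alternating_add:
  "alternating (a + b) x y = (if even b then alternating a x y else alternating a y x) @ alternating b x y"
  by (induction b arbitrary: x y) auto

lemma alternating_Suc_Cons:
  "alternating (Suc k) x y = (if even k then y else x) # alternating k x y"
  using alternating_add[of "Suc 0" k x y] by (auto simp del: alternating.simps(2)) auto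

lemma rev_alternating:
  "rev (alternating k x y) = (if even k then alternating k y x else alternating k x y)"
proof (induction k arbitrary: x y)
  case (Suc k)
  have "rev (alternating (Suc k) x y) = y # rev (alternating k y x)" by simp
  then show ?case using Suc by (simp add: alternating_Suc_Cons del: alternating.simps(2))
qed simp

lemma concat_replicate_alternating: "concat (replicate m [x, y]) = alternating (2 * m) x y"
  by (induction m) (auto simp: alternating_Suc_Cons simp del: alternating.simps(2))

lemma braid_relation:
  assumes n: "coxeter_matrix n" and m: "n x y = enat m"
  shows "(alternating m x y, alternating m y x) \<in> coxeter_rel n"
proof -
  \<comment> \<open>\<open>z\<close> is the left half of the relator of length \<open>2 * m\<close>.
    For either parity its reversal, which is its inverse, is
    \<open>alternating m y x\<close>.\<close>
  define z where "z = (if even m then alternating m x y else alternating m y x)"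
  have z: "rev z = alternating m y x" by (simp add: z_def rev_alternating)
  have "(z @ alternating m x y, []) \<in> coxeter_rel n"
    using coxeter_rel.relator[where n = n and i = x and j = y and k = m and u = "[]" and v = "[]", OF m]
      alternating_add[of m m x y]
    by (simp add: concat_replicate_alternating z_def mult_2)
  from coxeter_rel_cong_left[OF this, of "rev z"]
  have "(rev z @ z @ alternating m x y, rev z) \<in> coxeter_rel n" by simp
  moreover have "(rev z @ z @ alternating m x y, alternating m x y) \<in> coxeter_rel n"
    using coxeter_rel_cong_right[OF coxeter_rel_rev[OF n, of z], of "alternating m x y"] by simp
  ultimately show ?thesis
    unfolding z using coxeter_rel.sym coxeter_rel.trans by blast
qed

text \<open>The ascent at \<open>x\<close> forces the last letter to be \<open>y\<close>; the
  remaining reduced prefix then has an ascent at \<open>y\<close>, so induction applies with the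
  letters exchanged.\<close>

lemma reduced_dihedral_alternating:
  assumes n: "coxeter_matrix n"
  shows "reduced_word n u \<Longrightarrow> set u \<subseteq> {x, y} \<Longrightarrow> ascent n u x \<Longrightarrow> u = alternating (length u) x y"
proof (induction u arbitrary: x y rule: rev_induct)
  case (snoc z u)
  then have "z = y" using ascent_snoc_neq[OF n snoc.prems(3)] by auto
  moreover have "u = alternating (length u) y x"
    using snoc.prems reduced_snoc_ascent[of n u z] reduced_appendD(1)[of n u "[z]"] \<open>z = y\<close>
    by (intro snoc.IH) auto
  ultimately show ?case by simp
qed simp

text \<open>Otherwise \<open>u\<close> ends in an alternating block as long as the exponent. The
  braid relation makes this block end in \<open>x\<close>, and appending \<open>x\<close> then
  shortens \<open>u\<close>, against the ascent.\<close>

lemma reduced_dihedral_length: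
  assumes n: "coxeter_matrix n" and xy: "x \<noteq> y"
    and u: "reduced_word n u" "set u \<subseteq> {x, y}" "ascent n u x"
  shows "enat (length u) < n x y"
proof (rule ccontr)
  assume "\<not> enat (length u) < n x y"
  then obtain m where m: "n x y = enat m" "m \<le> length u"
    by (cases "n x y") auto
  have "2 \<le> n x y" using n xy by (simp add: coxeter_matrix_def)
  then obtain l where l: "m = Suc l"
    using m by (cases m) (auto simp: zero_enat_def[symmetric])
  obtain r where r: "length u = r + m" using m(2) by (metis add.commute le_Suc_ex)
  obtain v where v: "alternating (r + m) x y = v @ alternating m x y" "length v = r"
    using alternating_add[of r m x y] by (metis length_alternating)
  have "(v @ alternating m x y, (v @ alternating l x y) @ [x]) \<in> coxeter_rel n"
    using coxeter_rel_cong_left[OF braid_relation[OF n m(1)], of v] by (simp add: l)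
  moreover have "u = v @ alternating m x y"
    using reduced_dihedral_alternating[OF n u] by (simp add: r v)
  ultimately have "(u @ [x], v @ alternating l x y) \<in> coxeter_rel n"
    using coxeter_rel_snoc_move[OF n] by blast
  then show False using u(3) v(2) r l by (fastforce simp: ascent_def)
qed

section \<open>Chebyshev numbers\<close>

text \<open>This is the Chebyshev polynomial of the second kind of degree \<open>k - 1\<close> at
  \<open>\<kappa> / 2\<close>, indexed so that it equals sin (k t) / sin t at
  \<open>\<kappa> = 2 * cos t\<close>.\<close>

fun cheb :: "real \<Rightarrow> nat \<Rightarrow> real" where
  "cheb \<kappa> 0 = 0"
| "cheb \<kappa> (Suc 0) = 1"
| "cheb \<kappa> (Suc (Suc k)) = \<kappa> * cheb \<kappa> (Suc k) - cheb \<kappa> k"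

lemma cheb_cos: "cheb (2 * cos t) k * sin t = sin (real k * t)"
proof (induction "2 * cos t" k rule: cheb.induct)
  case (3 k)
  have "sin (real (Suc (Suc k)) * t) = 2 * cos t * sin (real (Suc k) * t) - sin (real k * t)"
    using sin_add[of "real (Suc k) * t" t] sin_diff[of "real (Suc k) * t" t]
    by (simp add: algebra_simps)
  with 3 show ?case by (simp add: algebra_simps)
qed auto

text \<open>Serves the infinite exponent. The bound on increments is carried along because
  positivity alone does not propagate through the recurrence.\<close>

lemma cheb_ge:
  assumes "2 \<le> \<kappa>"
  shows "real k \<le> cheb \<kappa> k \<and> cheb \<kappa> k + 1 \<le> cheb \<kappa> (Suc k)"
proof (induction k)
  case (Suc k)
  have "2 * cheb \<kappa> (Suc k) \<le> \<kappa> * cheb \<kappa> (Suc k)"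
    using Suc assms by (intro mult_right_mono) auto
  with Suc show ?case
    by (intro conjI; simp only: cheb.simps of_nat_Suc; linarith)
qed simp

section \<open>The action in terms of the Cartan matrix\<close>

lemma word_act_linear: "linear (word_act C w)"
proof (induction w)
  case Nil
  then show ?case by (simp add: linear_iff)
next
  case (Cons i w)
  have "linear (simple_refl C i)"
    by (auto simp: linear_iff simple_refl_def vec_eq_iff algebra_simps sum.distrib sum_distrib_left)
  from linear_compose[OF Cons this] show ?case
    by (simp add: o_def)
qed

lemma word_act_rev: "word_act C (rev w) (word_act C w \<beta>) = \<beta>"
  by (induction w arbitrary: \<beta>) (simp_all add: simple_refl_involution)

lemma word_act_inj: "word_act C w \<beta> = word_act C w \<gamma> \<Longrightarrow> \<beta> = \<gamma>"
  by (metis word_act_rev)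

lemma simple_root_nth: "simple_root i $ j = (if j = i then 1 else 0)"
  by (simp add: simple_root_def axis_def)

lemma inner_simple_root: "simple_root i \<bullet> v = v $ i" "v \<bullet> simple_root i = v $ i"
  by (simp_all add: simple_root_def inner_axis inner_axis')

lemma simple_root_ne_0: "simple_root i \<noteq> 0"
  by (metis simple_root_nth zero_index zero_neq_one)

lemma fire_eq: "fire C i v = v - v $ i *\<^sub>R C $ i"
  by (simp add: fire_def vec_eq_iff algebra_simps)

lemma proportional_if_support:
  "(\<And>k. k \<noteq> j \<Longrightarrow> \<beta> $ k = 0) \<Longrightarrow> \<beta> = (\<beta> $ j) *\<^sub>R simple_root j"
  by (auto simp: vec_eq_iff simple_root_nth)

locale weighted_coxeter =
  fixes n :: "'i::finite \<Rightarrow> 'i \<Rightarrow> enat" and C :: "real ^ 'i ^ 'i"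
  assumes cox: "coxeter_matrix n" and cartan: "cartan_matrix n C"
    and odd_sym: "n i j = enat k \<Longrightarrow> odd k \<Longrightarrow> C $ i $ j = C $ j $ i"
begin

lemma simple_refl_eq: "simple_refl C i \<beta> = \<beta> - (C $ i \<bullet> \<beta>) *\<^sub>R simple_root i"
proof -
  have "C $ i \<bullet> \<beta> = (\<Sum>k\<in>UNIV. C $ i $ k * \<beta> $ k)"
    by (simp add: inner_vec_def)
  also have "\<dots> = 2 * \<beta> $ i + (\<Sum>k\<in>UNIV - {i}. C $ i $ k * \<beta> $ k)"
    using cartan by (subst sum.remove[of UNIV i]) (auto simp: cartan_matrix_def)
  finally show ?thesis
    by (auto simp: vec_eq_iff simple_refl_def simple_root_nth)
qed

lemma simple_refl_other: "j \<noteq> i \<Longrightarrow> simple_refl C i \<beta> $ j = \<beta> $ j"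
  by (simp add: simple_refl_def)

lemma cartan_diag: "C $ i $ i = 2"
  using cartan by (simp add: cartan_matrix_def)

lemma simple_refl_simple_root: "simple_refl C i (simple_root i) = - simple_root i"
  by (simp add: simple_refl_eq inner_simple_root cartan_diag scaleR_2)

lemma inner_fire: "\<beta> \<bullet> fire C i v = simple_refl C i \<beta> \<bullet> v"
  by (simp add: fire_eq simple_refl_eq inner_diff_left inner_diff_right inner_simple_root inner_commute)

section \<open>Positivity of roots\<close>

text \<open>In the basis of \<open>simple_root i\<close> and \<open>l\<close> times
  \<open>simple_root t\<close>, both off-diagonal entries of the rank two Cartan matrix become
  \<open>- \<kappa>\<close>. The last clause concerns the exponent \<open>Suc m\<close>: it is odd
  when \<open>m\<close> is even, and then no rescaling takes place.\<close>

lemma dihedral_coefficients: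
  assumes it: "i \<noteq> t"
  obtains l \<kappa> where "0 < l" "l * \<kappa> = - C $ t $ i" "\<kappa> = - C $ i $ t * l"
    "\<forall>k. enat k < n i t \<longrightarrow> 0 < k \<longrightarrow> 0 < cheb \<kappa> k"
    "\<forall>m. n i t = enat (Suc m) \<longrightarrow> cheb \<kappa> (Suc m) = 0 \<and> cheb \<kappa> m = 1 \<and> (even m \<longrightarrow> l = 1)"
proof -
  note goal = that
  \<comment> \<open>Covers every finite exponent, including 2. With
    \<open>\<kappa> = 2 * cos \<theta>\<close>, the Chebyshev numbers are quotients of sines,
    positive before \<open>m\<close> and zero at \<open>m\<close>.\<close>
  have fin: thesis
    if m: "n i t = enat m" and l: "0 < l" "l * (2 * cos (pi / real m)) = - C $ t $ i"
      "2 * cos (pi / real m) = - C $ i $ t * l" "odd m \<Longrightarrow> l = 1" for m l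
  proof -
    have "2 \<le> n i t" using cox it by (simp add: coxeter_matrix_def)
    then have m2: "2 \<le> m" using m by (simp add: numeral_eq_enat)
    define \<theta> where "\<theta> = pi / real m"
    have \<theta>: "0 < \<theta>" "\<theta> < pi" "real m * \<theta> = pi" using m2 by (auto simp: \<theta>_def field_simps)
    have s: "0 < sin \<theta>" using \<theta> by (simp add: sin_gt_zero)
    have pos: "0 < cheb (2 * cos \<theta>) k" if "k < m" "0 < k" for k
    proof -
      have "real k * \<theta> < real m * \<theta>" using that(1) \<theta>(1) by simp
      also note \<theta>(3)
      finally have "real k * \<theta> < pi" .
      then have "0 < sin (real k * \<theta>)"
        using that \<theta> by (intro sin_gt_zero) auto
      then show ?thesis using s by (simp add: cheb_cos[symmetric] zero_less_mult_iff)
    qed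
    have "cheb (2 * cos \<theta>) m * sin \<theta> = 0"
      by (simp add: cheb_cos \<theta>)
    then have z: "cheb (2 * cos \<theta>) m = 0" using s by simp
    have o: "cheb (2 * cos \<theta>) k = 1" if "m = Suc k" for k
    proof -
      have "real k * \<theta> = pi - \<theta>" using that \<theta>(3) by (simp add: algebra_simps)
      then have "cheb (2 * cos \<theta>) k * sin \<theta> = sin \<theta>" by (simp add: cheb_cos)
      then show ?thesis using s by simp
    qed
    show thesis
      using l m pos z o by (intro goal[of l "2 * cos \<theta>"]) (auto simp: \<theta>_def)
  qed
  show thesis
  proof (cases "adjacent n i t")
    case True
    then have neg: "C $ i $ t < 0" "C $ t $ i < 0"
      and cs: "case n i t of enat k \<Rightarrow> C $ i $ t * C $ t $ i = 4 * (cos (pi / real k))\<^sup>2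
         | \<infinity> \<Rightarrow> C $ i $ t * C $ t $ i \<ge> 4"
      using cartan unfolding cartan_matrix_def by blast+
    \<comment> \<open>Any positive square root \<open>\<kappa>\<close> of the product of the two
      entries determines a suitable \<open>l\<close>.\<close>
    have scale: "0 < - C $ t $ i / \<kappa>" "- C $ t $ i / \<kappa> * \<kappa> = - C $ t $ i"
      "\<kappa> = - C $ i $ t * (- C $ t $ i / \<kappa>)"
      if \<kappa>: "0 < \<kappa>" "\<kappa> * \<kappa> = C $ i $ t * C $ t $ i" for \<kappa>
    proof -
      show "0 < - C $ t $ i / \<kappa>" using neg(2) \<kappa>(1) by (intro divide_pos_pos) auto
      show "- C $ t $ i / \<kappa> * \<kappa> = - C $ t $ i" using \<kappa>(1) by simp
      have "- C $ i $ t * (- C $ t $ i / \<kappa>) = \<kappa> * \<kappa> / \<kappa>" unfolding \<kappa>(2) by simp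
      then show "\<kappa> = - C $ i $ t * (- C $ t $ i / \<kappa>)" using \<kappa>(1) by simp
    qed
    show thesis
    proof (cases "n i t")
      case (enat m)
      then have m3: "3 \<le> m" using True by (simp add: adjacent_def numeral_eq_enat)
      then have "pi / real m < pi / 2" by (simp add: field_simps)
      then have c: "0 < cos (pi / real m)" using m3 by (intro cos_gt_zero) auto
      have ab: "C $ i $ t * C $ t $ i = 4 * (cos (pi / real m))\<^sup>2" using cs enat by simp
      \<comment> \<open>This is where the symmetry at odd exponents enters: both entries equal
        \<open>- 2 * cos (pi / real m)\<close>, whence \<open>l = 1\<close>.\<close>
      have one: "- C $ t $ i / (2 * cos (pi / real m)) = 1" if "odd m"
      proof -
        have "C $ i $ t = C $ t $ i" by (rule odd_sym[OF enat that])
        then have "(- C $ t $ i)\<^sup>2 = C $ i $ t * C $ t $ i"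
          unfolding power2_eq_square by simp
        then have "(- C $ t $ i)\<^sup>2 = (2 * cos (pi / real m))\<^sup>2"
          unfolding ab power_mult_distrib by simp
        then have "- C $ t $ i = 2 * cos (pi / real m)"
          by (rule power2_eq_imp_eq) (use neg c in linarith)+
        then show ?thesis using c by simp
      qed
      have "0 < 2 * cos (pi / real m)"
        "2 * cos (pi / real m) * (2 * cos (pi / real m)) = C $ i $ t * C $ t $ i"
        using c ab by (simp_all add: power2_eq_square)
      from scale[OF this] one show thesis by (rule fin[OF enat])
    next
      case infinity
      define \<kappa> where "\<kappa> = sqrt (C $ i $ t * C $ t $ i)"
      have ab: "4 \<le> C $ i $ t * C $ t $ i" using cs infinity by simp
      then have k2: "2 \<le> \<kappa>" unfolding \<kappa>_def by (intro real_le_rsqrt) simp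
      then have k0: "0 < \<kappa>" by simp
      have kk: "\<kappa> * \<kappa> = C $ i $ t * C $ t $ i" using ab by (simp add: \<kappa>_def)
      have pos: "0 < cheb \<kappa> k" if "0 < k" for k
        using cheb_ge[OF k2, of k] that by linarith
      show thesis
        using scale[OF k0 kk] by (rule goal) (use pos infinity in auto)
    qed
  next
    case False
    have "\<not> adjacent n t i" using False cox by (auto simp: adjacent_def coxeter_matrix_def)
    then have ab: "C $ i $ t = 0" "C $ t $ i = 0"
      using False it cartan unfolding cartan_matrix_def by metis+
    have "2 \<le> n i t" using cox it by (simp add: coxeter_matrix_def)
    then have "n i t = enat 2"
      using False it by (cases "n i t") (auto simp: adjacent_def numeral_eq_enat)
    \<comment> \<open>Here \<open>\<kappa>\<close> is 0, so every positive \<open>l\<close>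
      satisfies the equations.\<close>
    then show thesis by (rule fin[of _ 1]) (simp_all add: ab)
  qed
qed

text \<open>In the rescaled basis the coefficients are two consecutive Chebyshev numbers; each
  further reflection replaces the older one by the next, by the three-term recurrence.\<close>

lemma alternating_act:
  assumes it: "i \<noteq> t" and l: "l * \<kappa> = - C $ t $ i" "\<kappa> = - C $ i $ t * l"
  shows "word_act C (alternating k i t) (simple_root i) =
    (if even k then cheb \<kappa> (Suc k) *\<^sub>R simple_root i + (l * cheb \<kappa> k) *\<^sub>R simple_root t
     else cheb \<kappa> k *\<^sub>R simple_root i + (l * cheb \<kappa> (Suc k)) *\<^sub>R simple_root t)"
proof (induction k)
  case (Suc k)
  have refl_i: "simple_refl C i (p *\<^sub>R simple_root i + q *\<^sub>R simple_root t)
      = (- p - C $ i $ t * q) *\<^sub>R simple_root i + q *\<^sub>R simple_root t" for p q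
    using it by (auto simp: vec_eq_iff simple_refl_eq inner_simple_root inner_add_right
        cartan_diag simple_root_nth)
  have refl_t: "simple_refl C t (p *\<^sub>R simple_root i + q *\<^sub>R simple_root t)
      = p *\<^sub>R simple_root i + (- q - C $ t $ i * p) *\<^sub>R simple_root t" for p q
    using it by (auto simp: vec_eq_iff simple_refl_eq inner_simple_root inner_add_right
        cartan_diag simple_root_nth)
  have ct: "C $ t $ i = - (l * \<kappa>)" using l(1) by linarith
  have "- (l * cheb \<kappa> k) - C $ t $ i * cheb \<kappa> (Suc k) = l * cheb \<kappa> (Suc (Suc k))"
    unfolding ct by (simp add: algebra_simps)
  moreover have "- cheb \<kappa> k - C $ i $ t * (l * cheb \<kappa> (Suc k)) = cheb \<kappa> (Suc (Suc k))"
  proof -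
    have "- C $ i $ t * (l * cheb \<kappa> (Suc k)) = \<kappa> * cheb \<kappa> (Suc k)"
      using arg_cong[OF l(2), of "\<lambda>x. x * cheb \<kappa> (Suc k)"] by (simp only: mult.assoc)
    then show ?thesis unfolding cheb.simps by linarith
  qed
  ultimately show ?case
    unfolding alternating_Suc_Cons word_act_Cons Suc
    by (cases "even k") (simp_all only: refl_i refl_t even_Suc if_True if_False simp_thms)
qed simp

text \<open>The length of \<open>u\<close> is below the exponent, so both Chebyshev numbers are
  nonnegative. Apart from the empty word, one vanishes only at length one less than the exponent.
  The surviving coefficient is then 1, or \<open>l\<close> if the exponent is odd, and in that case
  \<open>l = 1\<close>.\<close>

lemma dihedral_act:
  assumes it: "i \<noteq> t" and u: "reduced_word n u" "set u \<subseteq> {i, t}" "ascent n u i"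
  obtains p q where "word_act C u (simple_root i) = p *\<^sub>R simple_root i + q *\<^sub>R simple_root t"
    "0 \<le> p" "0 \<le> q" "p = 0 \<longrightarrow> q = 1" "q = 0 \<longrightarrow> p = 1"
proof -
  obtain l \<kappa> where l: "0 < l" "l * \<kappa> = - C $ t $ i" "\<kappa> = - C $ i $ t * l"
    and pos: "\<forall>k. enat k < n i t \<longrightarrow> 0 < k \<longrightarrow> 0 < cheb \<kappa> k"
    and top: "\<forall>m. n i t = enat (Suc m) \<longrightarrow>
      cheb \<kappa> (Suc m) = 0 \<and> cheb \<kappa> m = 1 \<and> (even m \<longrightarrow> l = 1)"
    by (rule dihedral_coefficients[OF it])
  define k where "k = length u"
  have u_eq: "u = alternating k i t"
    using reduced_dihedral_alternating[OF cox u] by (simp add: k_def)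
  have k: "enat k < n i t"
    using reduced_dihedral_length[OF cox it u] by (simp add: k_def)
  have k1: "k = 0 \<or> 0 < cheb \<kappa> k" using pos k by auto
  have k2: "0 < cheb \<kappa> (Suc k) \<or> cheb \<kappa> (Suc k) = 0 \<and> cheb \<kappa> k = 1 \<and> (even k \<longrightarrow> l = 1)"
  proof (cases "enat (Suc k) < n i t")
    case False
    then have "n i t = enat (Suc k)" using k by (cases "n i t") auto
    then show ?thesis using top by blast
  qed (use pos in blast)
  show thesis
  proof (cases "even k")
    case True
    show thesis
      by (rule that[of "cheb \<kappa> (Suc k)" "l * cheb \<kappa> k"])
        (use True k1 k2 l(1) in \<open>auto simp: u_eq alternating_act[OF it l(2,3)]\<close>)
  next
    case False
    show thesis
      by (rule that[of "cheb \<kappa> k" "l * cheb \<kappa> (Suc k)"])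
        (use False k1 k2 l(1) in \<open>auto simp: u_eq alternating_act[OF it l(2,3)]\<close>)
  qed
qed

text \<open>Write \<open>w\<close> as \<open>v @ u\<close> with \<open>u\<close> in a rank two
  subgroup. Then \<open>u\<close> sends \<open>simple_root i\<close> to a nonnegative combination of
  two simple roots, at both of which the shorter word \<open>v\<close> has an ascent. The claim on
  multiples is proved in the same induction.\<close>

lemma ascent_positive:
  "reduced_word n w \<Longrightarrow> ascent n w i \<Longrightarrow>
    (\<forall>j. 0 \<le> word_act C w (simple_root i) $ j) \<and>
    (\<forall>c j. word_act C w (simple_root i) = c *\<^sub>R simple_root j \<longrightarrow> c = 1)"
proof (induction "length w" arbitrary: w i rule: less_induct)
  case less
  show ?case
  proof (cases w rule: rev_cases)
    case Nil
    then show ?thesis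
      by (auto simp: simple_root_nth vec_eq_iff split: if_splits)
  next
    case (snoc w0 t)
    have ti: "t \<noteq> i" using ascent_snoc_neq[OF cox] less.prems snoc by blast
    obtain v u where rel: "(w, v @ u) \<in> coxeter_rel n" and u: "set u \<subseteq> {i, t}"
      and len: "length v \<le> length w0" and red: "reduced_word n v" "reduced_word n u"
      and asc: "ascent n v i" "ascent n v t" "ascent n u i"
      using coset_decomposition[OF cox, of w0 t i] less.prems unfolding snoc by metis
    obtain p q where pq: "word_act C u (simple_root i) = p *\<^sub>R simple_root i + q *\<^sub>R simple_root t"
        "0 \<le> p" "0 \<le> q" "p = 0 \<longrightarrow> q = 1" "q = 0 \<longrightarrow> p = 1"
      by (rule dihedral_act[OF ti[symmetric] red(2) u asc(3)])
    let ?x = "word_act C v (simple_root i)" and ?y = "word_act C v (simple_root t)"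
    interpret lin: linear "word_act C v" by (rule word_act_linear)
    have w: "word_act C w (simple_root i) = p *\<^sub>R ?x + q *\<^sub>R ?y"
      by (simp add: word_act_cong[OF cox cartan rel] pq lin.add lin.scaleR)
    have lv: "length v < length w" using len snoc by simp
    note IHx = less.hyps[OF lv red(1) asc(1)] and IHy = less.hyps[OF lv red(1) asc(2)]
    have "c = 1" if c: "p *\<^sub>R ?x + q *\<^sub>R ?y = c *\<^sub>R simple_root j" for c j
    proof (cases "p = 0 \<or> q = 0")
      case True
      then have "?y = c *\<^sub>R simple_root j \<or> ?x = c *\<^sub>R simple_root j"
        using c pq(4,5) by auto
      then show ?thesis using IHx IHy by blast
    next
      case False
      then have p: "0 < p" "0 < q" using pq by auto
      \<comment> \<open>Nonnegative vectors cannot cancel, so both images are multiples of the same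
        simple root. By induction both are equal to it, against injectivity.\<close>
      have z: "?x $ k = 0 \<and> ?y $ k = 0" if "k \<noteq> j" for k
      proof -
        have "p * ?x $ k + q * ?y $ k = 0"
          using arg_cong[OF c, of "\<lambda>z. z $ k"] that by (simp add: simple_root_nth)
        moreover have "0 \<le> p * ?x $ k" "0 \<le> q * ?y $ k" using p IHx IHy by auto
        ultimately show ?thesis using p by (simp add: add_nonneg_eq_0_iff)
      qed
      have xy: "?x = (?x $ j) *\<^sub>R simple_root j" "?y = (?y $ j) *\<^sub>R simple_root j"
        using z proportional_if_support by blast+
      have "?x $ j = 1" using xy(1) IHx by blast
      moreover have "?y $ j = 1" using xy(2) IHy by blast
      ultimately have "?x = ?y" using xy by simp
      then have "simple_root i = simple_root t" by (rule word_act_inj)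
      then show ?thesis using ti by (metis simple_root_nth zero_neq_one)
    qed
    moreover have "0 \<le> (p *\<^sub>R ?x + q *\<^sub>R ?y) $ j" for j
      using pq IHx IHy by simp
    ultimately show ?thesis unfolding w by blast
  qed
qed

text \<open>Without an ascent, \<open>w @ [i]\<close> has a shorter reduced representative
  \<open>u\<close> with an ascent at \<open>i\<close>, and \<open>w\<close> and \<open>u\<close>
  send \<open>simple_root i\<close> to opposite vectors. The second alternative keeps
  \<open>u\<close> available for shortening words that realize a depth.\<close>

lemma word_act_sign:
  obtains "\<forall>j. 0 \<le> word_act C w (simple_root i) $ j"
      "\<forall>c j. word_act C w (simple_root i) = c *\<^sub>R simple_root j \<longrightarrow> c = 1"
  | u where "\<forall>j. word_act C w (simple_root i) $ j \<le> 0"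
      "(w @ [i], u) \<in> coxeter_rel n" "length u < length w"
proof -
  obtain w' where w': "(w, w') \<in> coxeter_rel n" "reduced_word n w'" "length w' \<le> length w"
    by (rule obtain_reduced)
  note eq = word_act_cong[OF cox cartan w'(1)]
  show thesis
  proof (cases "ascent n w' i")
    case True
    then show thesis using ascent_positive[OF w'(2)] that(1) unfolding eq by blast
  next
    case False
    then obtain u0 where u0: "(w' @ [i], u0) \<in> coxeter_rel n" "length u0 < length w'"
      unfolding ascent_def by (meson not_le)
    obtain u where u: "(u0, u) \<in> coxeter_rel n" "reduced_word n u" "length u \<le> length u0"
      by (rule obtain_reduced)
    have rel: "(w' @ [i], u) \<in> coxeter_rel n" using u0 u coxeter_rel.trans by blast
    then have relw: "(w @ [i], u) \<in> coxeter_rel n"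
      using coxeter_rel_cong_right[OF w'(1)] coxeter_rel.trans by blast
    have "ascent n u i"
      unfolding ascent_def
    proof (intro allI impI)
      fix z assume "(u @ [i], z) \<in> coxeter_rel n"
      moreover have "(w', u @ [i]) \<in> coxeter_rel n"
        using rel by (simp add: coxeter_rel_snoc_move[OF cox])
      ultimately have "length w' \<le> length z"
        using w'(2) coxeter_rel.trans unfolding reduced_word_def by blast
      then show "length u \<le> length z" using u u0 by simp
    qed
    then have "\<forall>j. 0 \<le> word_act C u (simple_root i) $ j"
      using ascent_positive u(2) by blast
    moreover have "word_act C u (simple_root i) = - word_act C w (simple_root i)"
      using word_act_cong[OF cox cartan relw]
      by (metis linear_neg[OF word_act_linear] simple_refl_simple_root word_act_append
          word_act_Cons word_act_Nil id_apply)
    ultimately show thesis using that(2)[OF _ relw] u u0 w'(3) by simp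
  qed
qed

section \<open>The root system and the sign of roots\<close>

lemma roots_iff: "\<beta> \<in> roots n C \<longleftrightarrow> (\<exists>w i. \<beta> = word_act C w (simple_root i))"
proof -
  have "orbit (coxeter_group n) (coxeter_act C) x = {word_act C w x |w. True}" for x
    unfolding orbit_def
    using coxeter_carrier_iff[of _ n] coxeter_act_class[OF cox cartan] by (auto; metis)
  then show ?thesis by (auto simp: roots_def)
qed

lemma roots_word_act: "\<beta> \<in> roots n C \<Longrightarrow> word_act C w \<beta> \<in> roots n C"
  unfolding roots_iff by (metis word_act_append)

lemma roots_simple_refl: "\<beta> \<in> roots n C \<Longrightarrow> simple_refl C i \<beta> \<in> roots n C"
  using roots_word_act[of \<beta> "[i]"] by simp

lemma simple_root_pos: "simple_root i \<in> pos_roots n C"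
proof -
  have "simple_root i = word_act C [] (simple_root i)" by simp
  then have "simple_root i \<in> roots n C" unfolding roots_iff by blast
  then show ?thesis by (simp add: pos_roots_def simple_root_nth)
qed

lemma root_ne_0:
  assumes "\<beta> \<in> roots n C"
  shows "\<beta> \<noteq> 0"
proof
  assume "\<beta> = 0"
  then obtain w i where "word_act C w (simple_root i) = word_act C w 0"
    using assms linear_0[OF word_act_linear] unfolding roots_iff by metis
  then show False using word_act_inj simple_root_ne_0 by blast
qed

lemma roots_uminus:
  assumes "\<beta> \<in> roots n C"
  shows "- \<beta> \<in> roots n C"
proof -
  obtain w i where \<beta>: "\<beta> = word_act C w (simple_root i)" using assms roots_iff by blast
  have "- \<beta> = word_act C (w @ [i]) (simple_root i)"
    by (simp add: \<beta> simple_refl_simple_root linear_neg[OF word_act_linear])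
  then show ?thesis unfolding roots_iff by blast
qed

lemma neg_root_iff:
  assumes "\<beta> \<in> roots n C"
  shows "\<beta> \<in> uminus ` pos_roots n C \<longleftrightarrow> (\<forall>j. \<beta> $ j \<le> 0)"
proof
  assume "\<forall>j. \<beta> $ j \<le> 0"
  then have "- \<beta> \<in> pos_roots n C" using assms roots_uminus by (simp add: pos_roots_def)
  then show "\<beta> \<in> uminus ` pos_roots n C" by (metis image_eqI minus_minus)
qed (auto simp: pos_roots_def)

lemma root_cases:
  assumes "\<beta> \<in> roots n C"
  shows "\<beta> \<in> pos_roots n C \<or> (\<forall>j. \<beta> $ j \<le> 0)"
proof -
  obtain w i where \<beta>: "\<beta> = word_act C w (simple_root i)" using assms roots_iff by blast
  show ?thesis
    by (rule word_act_sign[of w i]) (use assms in \<open>auto simp: \<beta> pos_roots_def\<close>)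
qed

lemma pos_not_neg:
  assumes "\<beta> \<in> pos_roots n C"
  shows "\<exists>j. 0 < \<beta> $ j"
proof -
  have "\<beta> \<noteq> 0" using assms root_ne_0 by (simp add: pos_roots_def)
  then obtain j where "\<beta> $ j \<noteq> 0" by (auto simp: vec_eq_iff)
  then show ?thesis using assms by (auto simp: pos_roots_def less_le)
qed

lemma pos_root_proportional:
  assumes \<beta>: "\<beta> \<in> pos_roots n C" and c: "\<beta> = c *\<^sub>R simple_root j"
  shows "\<beta> = simple_root j"
proof -
  obtain w i where w: "\<beta> = word_act C w (simple_root i)"
    using \<beta> by (auto simp: pos_roots_def roots_iff)
  have "c = 1"
  proof (rule word_act_sign[of w i])
    assume "\<forall>j. word_act C w (simple_root i) $ j \<le> 0"
    then show ?thesis using pos_not_neg[OF \<beta>] w by (auto simp: not_less[symmetric])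
  qed (metis c w)
  with c show ?thesis by simp
qed

text \<open>The reflection changes only coordinate \<open>i\<close>. A positive root other than
  \<open>simple_root i\<close> has another positive coordinate, which survives and rules out a
  negative image.\<close>

lemma simple_refl_pos:
  assumes "\<beta> \<in> pos_roots n C"
  shows "simple_refl C i \<beta> \<in> pos_roots n C \<or> \<beta> = simple_root i"
proof (rule disjCI)
  assume "\<beta> \<noteq> simple_root i"
  then have "\<beta> \<noteq> (\<beta> $ i) *\<^sub>R simple_root i" using pos_root_proportional[OF assms] by blast
  then obtain j where "j \<noteq> i" "\<beta> $ j \<noteq> 0" using proportional_if_support by blast
  then have "0 < simple_refl C i \<beta> $ j"
    using assms by (auto simp: simple_refl_other pos_roots_def less_le)
  moreover have "simple_refl C i \<beta> \<in> roots n C"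
    using assms roots_simple_refl by (simp add: pos_roots_def)
  ultimately show "simple_refl C i \<beta> \<in> pos_roots n C"
    using root_cases by (metis not_le)
qed

section \<open>Depth\<close>

lemma depth_le:
  assumes "\<beta> \<in> roots n C" "\<forall>j. word_act C w \<beta> $ j \<le> 0"
  shows "depth n C \<beta> \<le> enat (length w)"
  unfolding depth_def using neg_root_iff[OF roots_word_act[OF assms(1)]] assms(2)
  by (intro INF_lower) auto

lemma depth_attained:
  assumes "\<beta> \<in> roots n C"
  obtains w where "depth n C \<beta> = enat (length w)" "\<forall>j. word_act C w \<beta> $ j \<le> 0"
proof -
  let ?S = "{w. word_act C w \<beta> \<in> uminus ` pos_roots n C}"
  obtain w i where w: "\<beta> = word_act C w (simple_root i)" using assms roots_iff by blast
  \<comment> \<open>Undoing \<open>w\<close> and then negating the simple root shows that the depth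
    is finite.\<close>
  have "word_act C (i # rev w) \<beta> = - simple_root i"
    by (simp add: w word_act_rev simple_refl_simple_root)
  then have "i # rev w \<in> ?S" using simple_root_pos by simp
  then have "enat (length (i # rev w)) \<in> (\<lambda>w. enat (length w)) ` ?S" by (rule imageI)
  then have "Inf ((\<lambda>w. enat (length w)) ` ?S) \<in> (\<lambda>w. enat (length w)) ` ?S"
    by (rule wellorder_InfI)
  then show thesis
    using that neg_root_iff[OF roots_word_act[OF assms]] unfolding depth_def by auto
qed

lemma depth_simple_refl_le:
  assumes "\<beta> \<in> roots n C"
  shows "depth n C (simple_refl C i \<beta>) \<le> depth n C \<beta> + 1"
proof -
  obtain w where "depth n C \<beta> = enat (length w)" "\<forall>j. word_act C w \<beta> $ j \<le> 0"
    using depth_attained[OF assms] .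
  then show ?thesis
    using depth_le[OF roots_simple_refl[OF assms], of "w @ [i]" i]
    by (simp add: simple_refl_involution one_enat_def)
qed

lemma depth_simple_root: "depth n C (simple_root i) \<le> 1"
  using depth_le[of "simple_root i" "[i]"] simple_root_pos[of i]
  by (simp add: simple_refl_simple_root simple_root_nth pos_roots_def one_enat_def)

lemma depth_pos:
  assumes "\<beta> \<in> pos_roots n C"
  shows "1 \<le> depth n C \<beta>"
proof -
  have "\<beta> \<in> roots n C" using assms by (simp add: pos_roots_def)
  then obtain w where w: "depth n C \<beta> = enat (length w)" "\<forall>j. word_act C w \<beta> $ j \<le> 0"
    by (rule depth_attained)
  then have "w \<noteq> []" using pos_not_neg[OF assms] by (auto simp: not_le[symmetric])
  then show ?thesis using w by (cases w) (auto simp: one_enat_def)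
qed

text \<open>Let \<open>w\<close> be a shortest word making \<open>\<beta>\<close> negative.  If it makes \<open>\<alpha>\<^sub>i\<close> negative too, then a word
  shorter than \<open>w\<close> represents \<open>w s\<^sub>i\<close>; otherwise \<open>w\<close> sends \<open>s\<^sub>i \<beta>\<close> to a negative root that is not minus a
  simple root, so that the first letter of \<open>w\<close> can be dropped.\<close>

lemma depth_decreasing:
  assumes \<beta>: "\<beta> \<in> pos_roots n C" and ne: "\<beta> \<noteq> simple_root i" and c: "0 < C $ i \<bullet> \<beta>"
  shows "depth n C (simple_refl C i \<beta>) + 1 \<le> depth n C \<beta>"
proof -
  let ?\<gamma> = "simple_refl C i \<beta>"
  have r: "\<beta> \<in> roots n C" using \<beta> by (simp add: pos_roots_def)
  note r' = roots_simple_refl[OF r, of i]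
  obtain w where w: "depth n C \<beta> = enat (length w)" "\<forall>j. word_act C w \<beta> $ j \<le> 0"
    using depth_attained[OF r] .
  have "\<exists>x. length x < length w \<and> (\<forall>j. word_act C x ?\<gamma> $ j \<le> 0)"
  proof (rule word_act_sign[of w i])
    fix u assume u: "(w @ [i], u) \<in> coxeter_rel n" "length u < length w"
    have "word_act C u ?\<gamma> = word_act C w \<beta>"
      using word_act_cong[OF cox cartan u(1)] by (metis word_act_append word_act_Cons word_act_Nil
          id_apply simple_refl_involution)
    then show ?thesis using u w by auto
  next
    assume pos: "\<forall>j. 0 \<le> word_act C w (simple_root i) $ j"
    obtain s x where x: "w = s # x"
      using w(2) pos_not_neg[OF \<beta>] by (cases w) (auto simp: not_le[symmetric])
    \<comment> \<open>By minimality of \<open>w\<close>, dropping its first letter leaves a positive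
      root. As \<open>s\<close> makes it negative, it can only be
      \<open>simple_root s\<close>.\<close>
    have x\<beta>: "word_act C x \<beta> \<in> pos_roots n C"
      using root_cases[OF roots_word_act[OF r, of x]] depth_le[OF r, of x] w(1) x by auto
    then have "\<not> simple_refl C s (word_act C x \<beta>) \<in> pos_roots n C"
      using w(2) x pos_not_neg by (metis not_le word_act_Cons)
    then have x\<beta>': "word_act C x \<beta> = simple_root s" using simple_refl_pos[OF x\<beta>] by blast
    then have w\<beta>: "word_act C w \<beta> = - simple_root s" by (simp add: x simple_refl_simple_root)
    interpret lin: linear "word_act C w" by (rule word_act_linear)
    have w\<gamma>: "word_act C w ?\<gamma> =
        - simple_root s - (C $ i \<bullet> \<beta>) *\<^sub>R word_act C w (simple_root i)"
      by (simp add: simple_refl_eq lin.diff lin.scaleR w\<beta>)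
    \<comment> \<open>Otherwise \<open>s\<close> would turn a positive root into one with
      nonpositive entries, so \<open>x\<close> would send both \<open>?\<gamma>\<close> and
      \<open>\<beta>\<close> to \<open>simple_root s\<close>.\<close>
    have "\<not> word_act C x ?\<gamma> \<in> pos_roots n C"
    proof
      assume p: "word_act C x ?\<gamma> \<in> pos_roots n C"
      have nonneg: "0 \<le> (C $ i \<bullet> \<beta>) * word_act C w (simple_root i) $ j" for j
        using pos c by simp
      have "word_act C w ?\<gamma> $ j \<le> 0" for j
        unfolding w\<gamma> using nonneg[of j] by (cases "j = s") (simp_all add: simple_root_nth)
      then have "word_act C x ?\<gamma> = simple_root s"
        using simple_refl_pos[OF p, of s] pos_not_neg unfolding x by (metis not_le word_act_Cons)
      then have "?\<gamma> = \<beta>" using x\<beta>' word_act_inj by metis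
      then show False using c by (simp add: simple_refl_eq simple_root_ne_0)
    qed
    then show ?thesis using root_cases[OF roots_word_act[OF r']] x by auto
  qed
  then obtain x where "length x < length w" "\<forall>j. word_act C x ?\<gamma> $ j \<le> 0" by blast
  then have "depth n C ?\<gamma> \<le> enat (length x)" and x: "length x < length w"
    using depth_le[OF r'] by auto
  then have "depth n C ?\<gamma> + 1 \<le> enat (length x) + 1" by (intro add_right_mono)
  also have "\<dots> \<le> depth n C \<beta>" using x w(1) by (simp add: one_enat_def)
  finally show ?thesis .
qed

lemma inner_row_simple_refl: "C $ i \<bullet> simple_refl C i \<beta> = - (C $ i \<bullet> \<beta>)"
  by (simp add: simple_refl_eq inner_diff_right inner_simple_root cartan_diag)

section \<open>The numbers game\<close>

lemma m_number_le:
  assumes "\<beta> \<in> pos_roots n C" "\<beta> \<bullet> v < -1"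
  shows "m_number n C v \<le> depth n C \<beta> - 1"
  unfolding m_number_def using assms by (intro INF_lower) auto

lemma m_number_attained:
  assumes "\<exists>\<beta>\<in>pos_roots n C. \<beta> \<bullet> v < -1"
  obtains \<beta> where "\<beta> \<in> pos_roots n C" "\<beta> \<bullet> v < -1" "m_number n C v = depth n C \<beta> - 1"
proof -
  let ?S = "{\<beta> \<in> pos_roots n C. \<beta> \<bullet> v < -1}"
  obtain \<beta> where "\<beta> \<in> ?S" using assms by blast
  then have "depth n C \<beta> - 1 \<in> (\<lambda>\<beta>. depth n C \<beta> - 1) ` ?S" by (rule imageI)
  then have "Inf ((\<lambda>\<beta>. depth n C \<beta> - 1) ` ?S) \<in> (\<lambda>\<beta>. depth n C \<beta> - 1) ` ?S"
    by (rule wellorder_InfI)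
  then show thesis using that unfolding m_number_def by auto
qed

lemma m_number_infinity:
  "\<not> (\<exists>\<beta>\<in>pos_roots n C. \<beta> \<bullet> v < -1) \<Longrightarrow> m_number n C v = \<infinity>"
proof -
  assume "\<not> (\<exists>\<beta>\<in>pos_roots n C. \<beta> \<bullet> v < -1)"
  then have e: "{\<beta> \<in> pos_roots n C. \<beta> \<bullet> v < -1} = {}" by blast
  show ?thesis unfolding m_number_def e by (simp add: top_enat_def)
qed

lemma m_number_finite:
  assumes "\<beta> \<in> pos_roots n C" "\<beta> \<bullet> v < -1"
  shows "m_number n C v \<noteq> \<infinity>"
proof -
  have "\<beta> \<in> roots n C" using assms(1) by (simp add: pos_roots_def)
  then obtain w :: "'i list" where "depth n C \<beta> = enat (length w)" using depth_attained by blast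
  then show ?thesis using m_number_le[OF assms] by (cases "m_number n C v") (auto simp: one_enat_def)
qed

lemma m_number_forbidden:
  assumes "forbidden v"
  shows "m_number n C v = 0"
proof -
  obtain i where "v $ i < -1" using assms by (auto simp: forbidden_def)
  then have "m_number n C v \<le> depth n C (simple_root i) - 1"
    by (intro m_number_le simple_root_pos) (simp add: inner_simple_root)
  also have "\<dots> = 0"
    using depth_simple_root[of i] by (cases "depth n C (simple_root i)") (auto simp: one_enat_def zero_enat_def)
  finally show ?thesis by simp
qed

lemma m_number_le_fire:
  assumes "v $ i < 0"
  shows "m_number n C v \<le> m_number n C (fire C i v) + 1"
proof (cases "\<exists>\<beta>\<in>pos_roots n C. \<beta> \<bullet> fire C i v < -1")
  case True
  then obtain \<beta> where \<beta>: "\<beta> \<in> pos_roots n C" "\<beta> \<bullet> fire C i v < -1"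
    and m: "m_number n C (fire C i v) = depth n C \<beta> - 1"
    by (rule m_number_attained)
  \<comment> \<open>Firing negates coordinate \<open>i\<close>, which is positive
    afterwards.\<close>
  have "\<beta> \<noteq> simple_root i"
    using \<beta>(2) assms by (auto simp: inner_fire simple_refl_simple_root inner_simple_root)
  then have "simple_refl C i \<beta> \<in> pos_roots n C" using simple_refl_pos \<beta> by blast
  then have "m_number n C v \<le> depth n C (simple_refl C i \<beta>) - 1"
    using m_number_le \<beta>(2) by (simp add: inner_fire)
  \<comment> \<open>Subtraction is truncated, so \<open>depth_pos\<close> is needed to restore the
    depth.\<close>
  also have "\<dots> \<le> depth n C \<beta> - 1 + 1"
    using depth_simple_refl_le[of \<beta> i] depth_pos[OF \<beta>(1)] \<beta>(1)
    by (cases "depth n C \<beta>"; cases "depth n C (simple_refl C i \<beta>)")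
      (auto simp: one_enat_def pos_roots_def)
  finally show ?thesis by (simp add: m)
qed (simp add: m_number_infinity)

text \<open>A minimizing \<open>\<beta>\<close> is not \<open>simple_root i\<close>, as
  \<open>v\<close> is allowed. If its pairing with row \<open>i\<close> is nonpositive, firing does
  not raise its value and \<open>\<beta>\<close> still serves; otherwise its reflection serves, with
  smaller depth and the old value.\<close>

lemma m_number_fire_le:
  assumes "\<not> forbidden v" "v $ i < 0"
  shows "m_number n C (fire C i v) \<le> m_number n C v"
proof (cases "\<exists>\<beta>\<in>pos_roots n C. \<beta> \<bullet> v < -1")
  case True
  then obtain \<beta> where \<beta>: "\<beta> \<in> pos_roots n C" "\<beta> \<bullet> v < -1"
    and m: "m_number n C v = depth n C \<beta> - 1"
    by (rule m_number_attained)
  have ne: "\<beta> \<noteq> simple_root i"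
    using \<beta>(2) assms by (auto simp: inner_simple_root forbidden_def)
  show ?thesis
  proof (cases "C $ i \<bullet> \<beta> \<le> 0")
    case True
    then have "\<beta> \<bullet> fire C i v \<le> \<beta> \<bullet> v"
      using assms(2) by (simp add: fire_eq inner_diff_right inner_commute mult_nonpos_nonpos)
    then show ?thesis using m_number_le[OF \<beta>(1), of "fire C i v"] \<beta>(2) m by simp
  next
    case False
    then have "depth n C (simple_refl C i \<beta>) + 1 \<le> depth n C \<beta>"
      using depth_decreasing[OF \<beta>(1) ne] by simp
    then have "depth n C (simple_refl C i \<beta>) - 1 \<le> depth n C \<beta> - 1"
      by (cases "depth n C \<beta>"; cases "depth n C (simple_refl C i \<beta>)") (auto simp: one_enat_def)
    moreover have "simple_refl C i \<beta> \<in> pos_roots n C" using simple_refl_pos \<beta> ne by blast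
    ultimately show ?thesis
      using m_number_le[of "simple_refl C i \<beta>" "fire C i v"] \<beta>(2) m
      by (simp add: inner_fire simple_refl_involution)
  qed
qed (simp add: m_number_infinity)

section \<open>Lower and upper bounds on the number of moves\<close>

lemma m_number_le_moves:
  "reaches_forbidden_in C v k \<Longrightarrow> m_number n C v \<le> enat k"
proof (induction k arbitrary: v)
  case 0
  then show ?case by (simp add: reaches_forbidden_in_def m_number_forbidden)
next
  case (Suc k)
  then obtain u x where "move C v u" "(move C ^^ k) u x" "forbidden x"
    unfolding reaches_forbidden_in_def by (metis relpowp_Suc_D2)
  then have k: "m_number n C u \<le> enat k"
    using Suc.IH by (auto simp: reaches_forbidden_in_def)
  obtain i where "v $ i < 0" "u = fire C i v" using \<open>move C v u\<close> by (auto simp: move_def)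
  then have "m_number n C v \<le> m_number n C u + 1" using m_number_le_fire by blast
  also have "\<dots> \<le> enat k + 1" using k by (rule add_right_mono)
  finally show ?case by (simp add: one_enat_def)
qed

text \<open>\<open>d\<close> bounds the depth minus one. The number of moves is only bounded by
  \<open>d\<close>, since the root may also be lowered while the configuration stays fixed.\<close>

lemma reaches_forbidden_if_root:
  "\<beta> \<in> pos_roots n C \<Longrightarrow> \<beta> \<bullet> v < -1 \<Longrightarrow> depth n C \<beta> \<le> enat (Suc d) \<Longrightarrow>
    \<exists>k\<le>d. reaches_forbidden_in C v k"
proof (induction d arbitrary: \<beta> v rule: less_induct)
  case (less d)
  have r: "\<beta> \<in> roots n C" using less.prems by (simp add: pos_roots_def)
  obtain w where w: "depth n C \<beta> = enat (length w)" "\<forall>j. word_act C w \<beta> $ j \<le> 0"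
    using depth_attained[OF r] .
  have "w \<noteq> []" using pos_not_neg[OF less.prems(1)] w(2) by (auto simp: not_le[symmetric])
  \<comment> \<open>The last letter acts first, so reflecting in it leaves a root of depth at most
    \<open>length x\<close>.\<close>
  then obtain x i where x: "w = x @ [i]" by (metis rev_exhaust)
  let ?\<gamma> = "simple_refl C i \<beta>"
  show ?case
  proof (cases "\<beta> = simple_root i")
    case True
    then have "forbidden v" using less.prems(2) by (auto simp: forbidden_def inner_simple_root)
    then have "reaches_forbidden_in C v 0" by (simp add: reaches_forbidden_in_def)
    then show ?thesis by blast
  next
    case False
    then have \<gamma>: "?\<gamma> \<in> pos_roots n C" using simple_refl_pos less.prems by blast
    have dp: "depth n C ?\<gamma> \<le> enat (length x)"
      using depth_le[of ?\<gamma> x] roots_simple_refl[OF r] w(2) x by simp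
    have "1 \<le> length x" using depth_pos[OF \<gamma>] dp by (cases x) (auto simp: zero_enat_def[symmetric])
    moreover have "length x \<le> d" using less.prems(3) w(1) x by simp
    ultimately obtain e where e: "d = Suc e" "depth n C ?\<gamma> \<le> enat (Suc e)"
      using dp order_trans[OF dp, of "enat d"] by (cases d) auto
    show ?thesis
    proof (cases "v $ i < 0")
      case True
      have "?\<gamma> \<bullet> fire C i v < -1" using less.prems(2) by (simp add: inner_fire simple_refl_involution)
      then obtain k where k: "k \<le> e" "reaches_forbidden_in C (fire C i v) k"
        using less.IH[of e ?\<gamma>] e \<gamma> by blast
      have "move C v (fire C i v)" using True by (auto simp: move_def)
      then have "reaches_forbidden_in C v (Suc k)"
        using k(2) unfolding reaches_forbidden_in_def by (meson relpowp_Suc_I2)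
      then show ?thesis using k(1) e(1) by auto
    next
      case nonneg: False
      \<comment> \<open>A negative pairing would become positive for \<open>?\<gamma>\<close>, and
        \<open>depth_decreasing\<close> would make \<open>\<beta>\<close> the root of smaller
        depth.\<close>
      have "0 \<le> C $ i \<bullet> \<beta>"
      proof (rule ccontr)
        assume "\<not> 0 \<le> C $ i \<bullet> \<beta>"
        moreover have "?\<gamma> \<noteq> simple_root i"
        proof
          assume "?\<gamma> = simple_root i"
          then have "\<beta> = - simple_root i"
            using simple_refl_involution[of C i \<beta>] by (simp add: simple_refl_simple_root)
          then have "\<beta> $ i = -1" by (simp add: simple_root_nth)
          then show False using less.prems(1) by (auto simp: pos_roots_def dest: spec[of _ i])
        qed
        ultimately have "depth n C \<beta> + 1 \<le> depth n C ?\<gamma>"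
          using depth_decreasing[OF \<gamma>, of i]
          by (simp add: inner_row_simple_refl simple_refl_involution)
        then have "enat (length w) + 1 \<le> enat (length x)" using dp w(1) by (metis order_trans)
        then show False by (simp add: x one_enat_def)
      qed
      then have "?\<gamma> \<bullet> v \<le> \<beta> \<bullet> v"
        using nonneg by (simp add: simple_refl_eq inner_diff_left inner_simple_root)
      then obtain k where "k \<le> e" "reaches_forbidden_in C v k"
        using less.IH[of e ?\<gamma> v] e \<gamma> less.prems(2) by auto
      then show ?thesis using e(1) by (meson le_SucI)
    qed
  qed
qed

lemma min_moves_eq_m_number: "min_moves C v = m_number n C v"
proof (rule antisym)
  show "m_number n C v \<le> min_moves C v"
    unfolding min_moves_def by (rule INF_greatest) (simp add: m_number_le_moves)
  show "min_moves C v \<le> m_number n C v"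
  proof (cases "\<exists>\<beta>\<in>pos_roots n C. \<beta> \<bullet> v < -1")
    case True
    then obtain \<beta> where \<beta>: "\<beta> \<in> pos_roots n C" "\<beta> \<bullet> v < -1" "m_number n C v = depth n C \<beta> - 1"
      by (rule m_number_attained)
    have "m_number n C v \<noteq> \<infinity>" using m_number_finite \<beta> by blast
    then obtain d where d: "m_number n C v = enat d" by auto
    then have "depth n C \<beta> \<le> enat (Suc d)"
      using \<beta>(3) by (cases "depth n C \<beta>") (auto simp: one_enat_def)
    then obtain k where "k \<le> d" "reaches_forbidden_in C v k"
      using reaches_forbidden_if_root \<beta> by blast
    then have "min_moves C v \<le> enat k" unfolding min_moves_def by (intro INF_lower) auto
    then show ?thesis using d \<open>k \<le> d\<close> by (simp add: order_trans)
  qed (simp add: m_number_infinity)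
qed

lemma reaches_forbidden_iff:
  "(\<exists>k. reaches_forbidden_in C v k) \<longleftrightarrow> (\<exists>\<beta>\<in>pos_roots n C. \<beta> \<bullet> v < -1)"
proof
  assume "\<exists>k. reaches_forbidden_in C v k"
  then obtain k where "reaches_forbidden_in C v k" by blast
  from m_number_le_moves[OF this] have "m_number n C v \<noteq> \<infinity>" by (cases "m_number n C v") auto
  then show "\<exists>\<beta>\<in>pos_roots n C. \<beta> \<bullet> v < -1" by (rule contrapos_np) (rule m_number_infinity)
next
  assume "\<exists>\<beta>\<in>pos_roots n C. \<beta> \<bullet> v < -1"
  then obtain \<beta> where \<beta>: "\<beta> \<in> pos_roots n C" "\<beta> \<bullet> v < -1" by blast
  then have "\<beta> \<in> roots n C" by (simp add: pos_roots_def)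
  then obtain w :: "'i list" where "depth n C \<beta> = enat (length w)" using depth_attained by blast
  then have "depth n C \<beta> \<le> enat (Suc (length w))" by simp
  then show "\<exists>k. reaches_forbidden_in C v k" using reaches_forbidden_if_root[OF \<beta>] by blast
qed

lemma m_number_fire:
  assumes "\<not> forbidden v" "v $ i < 0"
  shows "m_number n C (fire C i v) \<in> {m_number n C v, m_number n C v - 1}"
  using m_number_fire_le[OF assms] m_number_le_fire[OF assms(2)]
  by (cases "m_number n C (fire C i v)"; cases "m_number n C v") (auto simp: one_enat_def)

end

theorem theorem5p3:
  fixes n :: "'i::finite \<Rightarrow> 'i \<Rightarrow> enat" and C :: "real ^ 'i ^ 'i"
  assumes "coxeter_matrix n"
    and "cartan_matrix n C"
    and "\<And>i j k. n i j = enat k \<Longrightarrow> odd k \<Longrightarrow> C $ i $ j = C $ j $ i"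
  shows "\<forall>v :: real ^ 'i.
       ((\<exists>k. reaches_forbidden_in C v k) \<longleftrightarrow> (\<exists>\<beta>\<in>pos_roots n C. \<beta> \<bullet> v < -1)) \<and>
       ((\<exists>k. reaches_forbidden_in C v k) \<longrightarrow> min_moves C v = m_number n C v) \<and>
       (\<forall>i. \<not> forbidden v \<and> v $ i < 0 \<longrightarrow>
          m_number n C (fire C i v) \<in> {m_number n C v, m_number n C v - 1})"
proof -
  interpret weighted_coxeter n C
    using assms by unfold_locales
  show ?thesis
    by (intro allI conjI impI reaches_forbidden_iff min_moves_eq_m_number m_number_fire) simp_all
qed

end
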